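(* Let $F:\mathbb{R}^n\to\mathbb{R}^n$ be a polynomial mapping of the form $F=\mathrm{Id}+N$, where $N:\mathbb{R}^n\to\mathbb{R}^n$ is a positive nilpotent morphism. Then $F$ is invertible.
   Context: A morphism (polynomial mapping) $N=(N_1,\dots,N_n):\mathbb{R}^n\to\mathbb{R}^n$ is given by polynomials $N_i\in\mathbb{R}[X_1,\dots,X_n]$. It is nilpotent if its Jacobi matrix $JN(X)=\left(\frac{\partial N_i}{\partial X_j}\right)$ satisfies $(JN(X))^n\equiv 0$ in the ring of $n\times n$ matrices over $\mathbb{R}[X_1,\dots,X_n]$. It is positive if all non-zero coefficients of the polynomials $N_i$ are positive. Invertible means possessing an inverse mapping which is also given by polynomials. *)

theory Defs
  imports "HOL-Analysis.Analysis" "HOL-Library.Poly_Mapping"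
begin

text \<open>
  The ring of real polynomials in the variables indexed by the finite type
  \<open>'n\<close>, i.e. \<open>n = CARD('n)\<close> variables.  An exponent vector is a map
  \<open>'n \<Rightarrow>\<^sub>0 nat\<close>, a polynomial assigns a coefficient to each exponent vector, and the
  ring operations are those of \<open>HOL-Library.Poly_Mapping\<close> (multiplication is convolution).
\<close>

type_synonym 'n mpoly = "('n \<Rightarrow>\<^sub>0 nat) \<Rightarrow>\<^sub>0 real"

definition mpoly_eval :: "'n::finite mpoly \<Rightarrow> real ^ 'n \<Rightarrow> real" where
  "mpoly_eval p x =
     (\<Sum>m\<in>Poly_Mapping.keys p. Poly_Mapping.lookup p m * (\<Prod>i\<in>UNIV. (x $ i) ^ Poly_Mapping.lookup m i))"

text \<open>
  Formal partial derivative.  The truncated subtraction on exponent vectors is harmless: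
  if the exponent of \<open>X\<^sub>j\<close> is \<open>0\<close>, the coefficient of the term is \<open>0\<close>.
\<close>

definition mpoly_pderiv :: "'n::finite \<Rightarrow> 'n mpoly \<Rightarrow> 'n mpoly" where
  "mpoly_pderiv j p =
     (\<Sum>m\<in>Poly_Mapping.keys p.
        Poly_Mapping.single (m - Poly_Mapping.single j 1)
          (real (Poly_Mapping.lookup m j) * Poly_Mapping.lookup p m))"

text \<open>
  A morphism is represented by its tuple of component polynomials.  Over the reals this tuple
  is determined by the induced mapping.
\<close>

type_synonym 'n morphism = "'n mpoly ^ 'n"

definition morphism_map :: "'n::finite morphism \<Rightarrow> real ^ 'n \<Rightarrow> real ^ 'n" where
  "morphism_map N x = (\<chi> i. mpoly_eval (N $ i) x)"

definition jacobi_matrix :: "'n::finite morphism \<Rightarrow> 'n mpoly ^ 'n ^ 'n" where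
  "jacobi_matrix N = (\<chi> i j. mpoly_pderiv j (N $ i))"

text \<open>
  Matrix power with respect to \<open>**\<close>; the overloaded \<open>^\<close> on \<open>vec\<close> is componentwise.
\<close>

definition matrix_power :: "'a::semiring_1 ^ 'n ^ 'n \<Rightarrow> nat \<Rightarrow> 'a ^ 'n ^ 'n" where
  "matrix_power A k = (((**) A) ^^ k) (mat 1)"

definition nilpotent_morphism :: "'n::finite morphism \<Rightarrow> bool" where
  "nilpotent_morphism N \<longleftrightarrow> matrix_power (jacobi_matrix N) CARD('n) = 0"

definition positive_morphism :: "'n::finite morphism \<Rightarrow> bool" where
  "positive_morphism N \<longleftrightarrow>
     (\<forall>i m. Poly_Mapping.lookup (N $ i) m \<noteq> 0 \<longrightarrow> Poly_Mapping.lookup (N $ i) m > 0)"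

definition polynomial_mapping :: "(real ^ 'n::finite \<Rightarrow> real ^ 'n) \<Rightarrow> bool" where
  "polynomial_mapping G \<longleftrightarrow> (\<exists>P. G = morphism_map P)"

definition polynomially_invertible :: "(real ^ 'n::finite \<Rightarrow> real ^ 'n) \<Rightarrow> bool" where
  "polynomially_invertible F \<longleftrightarrow> (\<exists>G. polynomial_mapping G \<and> G \<circ> F = id \<and> F \<circ> G = id)"

end

theory Submission
  imports Defs
begin

text \<open>
  Evaluate the Jacobi matrix at \<open>(1,\<dots>,1)\<close>. As all coefficients are nonnegative, this gives a
  nonnegative real matrix \<open>A\<close> with \<open>A\<^sub>i\<^sub>j = 0\<close> iff \<open>N\<^sub>i\<close> does not depend on \<open>X\<^sub>j\<close>, and nilpotency
  means that the dependency graph of \<open>N\<close> has no walk of length \<open>n\<close>. Hence the iteration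
  \<open>G\<^sub>0 = 0\<close>, \<open>G\<^sub>k\<^sub>+\<^sub>1(y) = y - N(G\<^sub>k(y))\<close> of polynomial mappings is stationary in the \<open>i\<close>-th component
  as soon as no walk of length \<open>k\<close> starts at \<open>i\<close>, and \<open>G\<^sub>n\<close> is the inverse of \<open>Id + N\<close>.
\<close>

section \<open>Evaluation as a ring homomorphism\<close>

lemma mpoly_eval_superset:
  assumes "finite S" "Poly_Mapping.keys p \<subseteq> S"
  shows "mpoly_eval p x =
    (\<Sum>m\<in>S. Poly_Mapping.lookup p m * (\<Prod>i\<in>UNIV. (x $ i) ^ Poly_Mapping.lookup m i))"
  unfolding mpoly_eval_def
  using assms by (intro sum.mono_neutral_left) (auto simp: in_keys_iff)

lemma mpoly_eval_0 [simp]: "mpoly_eval 0 x = 0"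
  by (simp add: mpoly_eval_def)

lemma mpoly_eval_add: "mpoly_eval (p + q) x = mpoly_eval p x + mpoly_eval q x"
proof -
  let ?S = "Poly_Mapping.keys p \<union> Poly_Mapping.keys q"
  have "Poly_Mapping.keys (p + q) \<subseteq> ?S"
    by (rule Poly_Mapping.keys_add)
  then show ?thesis
    by (simp add: mpoly_eval_superset[of ?S] lookup_add distrib_right sum.distrib)
qed

lemma mpoly_eval_sum: "mpoly_eval (\<Sum>a\<in>A. f a) x = (\<Sum>a\<in>A. mpoly_eval (f a) x)"
  by (induction A rule: infinite_finite_induct) (auto simp: mpoly_eval_add)

lemma mpoly_eval_single:
  "mpoly_eval (Poly_Mapping.single m c) x = c * (\<Prod>i\<in>UNIV. (x $ i) ^ Poly_Mapping.lookup m i)"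
  by (simp add: mpoly_eval_superset[of "{m}"])

lemma mpoly_eval_1 [simp]: "mpoly_eval 1 x = 1"
  by (simp add: mpoly_eval_single flip: single_one)

lemma poly_mapping_eq_sum_single:
  "p = (\<Sum>m\<in>Poly_Mapping.keys p. Poly_Mapping.single m (Poly_Mapping.lookup p m))"
proof (rule poly_mapping_eqI)
  fix k
  have "(\<Sum>m\<in>Poly_Mapping.keys p. Poly_Mapping.lookup p m when m = k) =
    (\<Sum>m\<in>Poly_Mapping.keys p. if m = k then Poly_Mapping.lookup p m else 0)"
    by (simp add: when_def)
  then show "Poly_Mapping.lookup p k = Poly_Mapping.lookup
    (\<Sum>m\<in>Poly_Mapping.keys p. Poly_Mapping.single m (Poly_Mapping.lookup p m)) k"
    by (simp add: lookup_sum lookup_single in_keys_iff)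
qed

text \<open>Expanding both factors into monomials reduces this to two monomials, where exponents add
  under multiplication.\<close>

lemma mpoly_eval_mult: "mpoly_eval (p * q) x = mpoly_eval p x * mpoly_eval q x"
proof -
  let ?s = "\<lambda>p m. Poly_Mapping.single m (Poly_Mapping.lookup p m)"
  have single: "mpoly_eval (?s p a * ?s q b) x = mpoly_eval (?s p a) x * mpoly_eval (?s q b) x" for a b
    by (simp add: mult_single mpoly_eval_single lookup_add power_add prod.distrib)
  have "mpoly_eval (sum (?s p) A * sum (?s q) B) x =
      mpoly_eval (sum (?s p) A) x * mpoly_eval (sum (?s q) B) x" for A B
    by (simp only: sum_product mpoly_eval_sum single)
  from this[of "Poly_Mapping.keys p" "Poly_Mapping.keys q"] show ?thesis
    by (simp only: poly_mapping_eq_sum_single[symmetric])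
qed

text \<open>A variable with exponent 0 contributes the factor 1 whatever its value, even at
  0.\<close>

lemma mpoly_eval_cong:
  assumes "\<And>m i. m \<in> Poly_Mapping.keys p \<Longrightarrow> Poly_Mapping.lookup m i \<noteq> 0 \<Longrightarrow> x $ i = y $ i"
  shows "mpoly_eval p x = mpoly_eval p y"
  unfolding mpoly_eval_def
proof (intro sum.cong refl arg_cong2[where f = "(*)"] prod.cong)
  fix m i
  assume "m \<in> Poly_Mapping.keys p"
  then show "(x $ i) ^ Poly_Mapping.lookup m i = (y $ i) ^ Poly_Mapping.lookup m i"
    using assms[of m i] by (cases "Poly_Mapping.lookup m i = 0") auto
qed

text \<open>At the all-ones vector every monomial has value 1, so only coefficients remain. If these
  are nonnegative, nothing can cancel.\<close>

lemma mpoly_eval_pderiv_at_ones: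
  "mpoly_eval (mpoly_pderiv j p) 1 =
    (\<Sum>m\<in>Poly_Mapping.keys p. real (Poly_Mapping.lookup m j) * Poly_Mapping.lookup p m)"
  by (simp add: mpoly_pderiv_def mpoly_eval_sum mpoly_eval_single)

section \<open>Polynomial functions and their closure properties\<close>

definition polynomial_fun :: "(real ^ 'n::finite \<Rightarrow> real) \<Rightarrow> bool" where
  "polynomial_fun f \<longleftrightarrow> (\<exists>p. f = mpoly_eval p)"

lemma polynomial_fun_const: "polynomial_fun (\<lambda>x. c)"
  unfolding polynomial_fun_def
  by (rule exI[of _ "Poly_Mapping.single 0 c"]) (simp add: fun_eq_iff mpoly_eval_single)

lemma polynomial_fun_component: "polynomial_fun (\<lambda>x. x $ i)"
  unfolding polynomial_fun_def
proof (intro exI ext)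
  fix x :: "real ^ 'a"
  have "(\<Prod>k\<in>UNIV. (x $ k) ^ (1 when i = k)) = (\<Prod>k\<in>UNIV. if k = i then x $ k else 1)"
    by (intro prod.cong) auto
  then show "x $ i = mpoly_eval (Poly_Mapping.single (Poly_Mapping.single i 1) 1) x"
    by (simp add: mpoly_eval_single lookup_single)
qed

lemma polynomial_fun_add:
  "polynomial_fun f \<Longrightarrow> polynomial_fun g \<Longrightarrow> polynomial_fun (\<lambda>x. f x + g x)"
  unfolding polynomial_fun_def fun_eq_iff by (metis mpoly_eval_add)

lemma polynomial_fun_mult:
  "polynomial_fun f \<Longrightarrow> polynomial_fun g \<Longrightarrow> polynomial_fun (\<lambda>x. f x * g x)"
  unfolding polynomial_fun_def fun_eq_iff by (metis mpoly_eval_mult)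

lemma polynomial_fun_diff:
  assumes "polynomial_fun f" "polynomial_fun g"
  shows "polynomial_fun (\<lambda>x. f x - g x)"
  using polynomial_fun_add[OF assms(1) polynomial_fun_mult[OF polynomial_fun_const[of "- 1"] assms(2)]]
  by simp

lemma polynomial_fun_sum:
  "(\<And>a. a \<in> A \<Longrightarrow> polynomial_fun (f a)) \<Longrightarrow> polynomial_fun (\<lambda>x. \<Sum>a\<in>A. f a x)"
  by (induction A rule: infinite_finite_induct)
    (auto intro: polynomial_fun_const polynomial_fun_add)

lemma polynomial_fun_prod:
  "(\<And>a. a \<in> A \<Longrightarrow> polynomial_fun (f a)) \<Longrightarrow> polynomial_fun (\<lambda>x. \<Prod>a\<in>A. f a x)"
  by (induction A rule: infinite_finite_induct)
    (auto intro: polynomial_fun_const polynomial_fun_mult)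

lemma polynomial_fun_power: "polynomial_fun f \<Longrightarrow> polynomial_fun (\<lambda>x. f x ^ k)"
  by (induction k) (auto intro: polynomial_fun_const polynomial_fun_mult)

lemma polynomial_mapping_iff: "polynomial_mapping G \<longleftrightarrow> (\<forall>i. polynomial_fun (\<lambda>x. G x $ i))"
proof
  assume "\<forall>i. polynomial_fun (\<lambda>x. G x $ i)"
  then obtain p where "\<And>i. (\<lambda>x. G x $ i) = mpoly_eval (p i)"
    unfolding polynomial_fun_def by metis
  then have "G = morphism_map (\<chi> i. p i)"
    by (auto simp: fun_eq_iff morphism_map_def vec_eq_iff)
  then show "polynomial_mapping G"
    unfolding polynomial_mapping_def by blast
qed (auto simp: polynomial_mapping_def polynomial_fun_def morphism_map_def)

text \<open>The value is a finite sum of products of powers of components of \<open>G\<close>, so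
  the closure rules replace a formal substitution of polynomials into polynomials.\<close>

lemma polynomial_fun_mpoly_eval_comp:
  assumes "polynomial_mapping G"
  shows "polynomial_fun (\<lambda>x. mpoly_eval p (G x))"
  using assms unfolding mpoly_eval_def polynomial_mapping_iff
  by (intro polynomial_fun_sum polynomial_fun_mult polynomial_fun_const polynomial_fun_prod
      polynomial_fun_power) auto

section \<open>The dependency graph and its walks\<close>

definition depends_on :: "'n::finite morphism \<Rightarrow> 'n \<Rightarrow> 'n \<Rightarrow> bool" where
  "depends_on N i j \<longleftrightarrow> (\<exists>m\<in>Poly_Mapping.keys (N $ i). Poly_Mapping.lookup m j \<noteq> 0)"

lemma morphism_map_cong:
  "(\<And>j. depends_on N i j \<Longrightarrow> x $ j = y $ j) \<Longrightarrow> morphism_map N x $ i = morphism_map N y $ i"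
  unfolding morphism_map_def by (auto simp: depends_on_def intro!: mpoly_eval_cong)

lemma positive_morphism_lookup_nonneg:
  "positive_morphism N \<Longrightarrow> 0 \<le> Poly_Mapping.lookup (N $ i) m"
  unfolding positive_morphism_def by (metis less_imp_le order_refl)

lemma mpoly_eval_jacobi_nonneg:
  "positive_morphism N \<Longrightarrow> 0 \<le> mpoly_eval (jacobi_matrix N $ i $ j) 1"
  by (auto simp: jacobi_matrix_def mpoly_eval_pderiv_at_ones positive_morphism_lookup_nonneg
      intro!: sum_nonneg)

text \<open>A monomial of \<open>N $ i\<close> containing the variable \<open>j\<close> contributes
  a positive term, and no other term is negative.\<close>

lemma mpoly_eval_jacobi_pos:
  assumes "positive_morphism N" "depends_on N i j"
  shows "0 < mpoly_eval (jacobi_matrix N $ i $ j) 1"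
proof -
  obtain m where m: "m \<in> Poly_Mapping.keys (N $ i)" "Poly_Mapping.lookup m j \<noteq> 0"
    using assms(2) by (auto simp: depends_on_def)
  have "0 < real (Poly_Mapping.lookup m j) * Poly_Mapping.lookup (N $ i) m"
    using m assms(1) by (auto simp: positive_morphism_def in_keys_iff)
  then show ?thesis
    unfolding jacobi_matrix_def
    using m(1) assms(1)
    by (auto simp: mpoly_eval_pderiv_at_ones positive_morphism_lookup_nonneg intro!: sum_pos2)
qed

lemma matrix_power_Suc_nth:
  "matrix_power A (Suc k) $ i $ l = (\<Sum>j\<in>UNIV. A $ i $ j * matrix_power A k $ j $ l)"
  by (simp add: matrix_power_def matrix_matrix_mult_def)

text \<open>The entry is a sum over walks of length \<open>k\<close> from \<open>i\<close> to
  \<open>l\<close> of products of edge weights. Its sign lets a vanishing sum be split into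
  vanishing summands.\<close>

lemma mpoly_eval_jacobi_power_nonneg:
  assumes "positive_morphism N"
  shows "0 \<le> mpoly_eval (matrix_power (jacobi_matrix N) k $ i $ l) 1"
proof (induction k arbitrary: i)
  case 0
  then show ?case
    by (simp add: matrix_power_def mat_def)
next
  case (Suc k)
  then show ?case
    by (simp add: matrix_power_Suc_nth mpoly_eval_sum mpoly_eval_mult
        mpoly_eval_jacobi_nonneg[OF assms] sum_nonneg)
qed

text \<open>The zero-row hypothesis says that no walk of length \<open>k\<close> starts at \<open>i\<close>.\<close>

lemma zero_row_induct [consumes 2, case_names step]:
  assumes pos: "positive_morphism N"
    and "\<And>l. mpoly_eval (matrix_power (jacobi_matrix N) k $ i $ l) 1 = 0"
    and step: "\<And>k i. (\<And>j. depends_on N i j \<Longrightarrow> P k j) \<Longrightarrow> P (Suc k) i"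
  shows "P k i"
  using assms(2)
proof (induction k arbitrary: i)
  case 0
  \<comment> \<open>Contradictory case: the diagonal entry of the identity matrix is 1, the empty
    walk at \<open>i\<close>. Hence the rule has no base case.\<close>
  from this[of i] show ?case
    by (simp add: matrix_power_def mat_def)
next
  case (Suc k)
  let ?J = "\<lambda>i j. mpoly_eval (jacobi_matrix N $ i $ j) 1"
  let ?B = "\<lambda>i j. mpoly_eval (matrix_power (jacobi_matrix N) k $ i $ j) 1"
  show ?case
  proof (rule step, rule Suc.IH)
    fix j l
    assume "depends_on N i j"
    then have "0 < ?J i j"
      by (rule mpoly_eval_jacobi_pos[OF pos])
    \<comment> \<open>Nonnegative summands with sum 0 all vanish; the positive factor
      \<open>?J i j\<close> then cancels.\<close>
    moreover have "(\<Sum>j\<in>UNIV. ?J i j * ?B j l) = 0"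
      using Suc.prems[of l] by (simp add: matrix_power_Suc_nth mpoly_eval_sum mpoly_eval_mult)
    then have "?J i j * ?B j l = 0"
      by (subst (asm) sum_nonneg_eq_0_iff)
        (auto simp: mpoly_eval_jacobi_nonneg[OF pos] mpoly_eval_jacobi_power_nonneg[OF pos])
    ultimately show "?B j l = 0"
      by simp
  qed
qed

text \<open>The power with exponent \<open>CARD('n)\<close> is 0, so all its rows vanish and the
  previous rule applies at every \<open>i\<close>.\<close>

lemma nilpotent_induct [consumes 2, case_names step]:
  fixes N :: "'n::finite morphism"
  assumes "positive_morphism N" "nilpotent_morphism N"
    and "\<And>k i. (\<And>j. depends_on N i j \<Longrightarrow> P k j) \<Longrightarrow> P (Suc k) i"
  shows "P CARD('n) i"
proof (rule zero_row_induct[where P = P, OF assms(1) _ assms(3)])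
  show "mpoly_eval (matrix_power (jacobi_matrix N) CARD('n) $ i $ l) 1 = 0" for l
    using assms(2) by (simp add: nilpotent_morphism_def)
qed

section \<open>The fixed-point iteration for \<open>x = y - morphism_map N x\<close>\<close>

primrec approx_inverse :: "'n::finite morphism \<Rightarrow> nat \<Rightarrow> real ^ 'n \<Rightarrow> real ^ 'n" where
  "approx_inverse N 0 y = 0"
| "approx_inverse N (Suc k) y = y - morphism_map N (approx_inverse N k y)"

lemma polynomial_mapping_approx_inverse: "polynomial_mapping (approx_inverse N k)"
proof (induction k)
  case 0
  then show ?case
    by (simp add: polynomial_mapping_iff polynomial_fun_const)
next
  case (Suc k)
  then show ?case
    by (subst polynomial_mapping_iff)
      (simp add: morphism_map_def polynomial_fun_diff polynomial_fun_component
        polynomial_fun_mpoly_eval_comp)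
qed

lemma approx_inverse_left:
  fixes N :: "'n::finite morphism"
  assumes "positive_morphism N" "nilpotent_morphism N"
  shows "approx_inverse N CARD('n) (x + morphism_map N x) = x"
proof -
  have "approx_inverse N CARD('n) (x + morphism_map N x) $ i = x $ i" for i
    using assms
  \<comment> \<open>\<open>CARD('n)\<close> is generalised to \<open>k\<close>. If iterate
    \<open>k\<close> agrees with \<open>x\<close> at all successors of \<open>i\<close>, both have
    the same image under \<open>N\<close> at \<open>i\<close>, and subtracting it from
    \<open>x + morphism_map N x\<close> leaves \<open>x $ i\<close>.\<close>
  proof (induction rule: nilpotent_induct)
    case (step k i)
    then show ?case
      using morphism_map_cong[of N i "approx_inverse N k (x + morphism_map N x)" x] by simp
  qed
  then show ?thesis
    by (simp add: vec_eq_iff)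
qed

text \<open>The same induction now compares consecutive iterates. Once iterates
  \<open>CARD('n)\<close> and \<open>Suc CARD('n)\<close> agree, the recursion reads
  \<open>G y = y - morphism_map N (G y)\<close>.\<close>

lemma approx_inverse_right:
  fixes N :: "'n::finite morphism"
  assumes "positive_morphism N" "nilpotent_morphism N"
  defines "G \<equiv> approx_inverse N CARD('n)"
  shows "G y + morphism_map N (G y) = y"
proof -
  have "approx_inverse N (Suc CARD('n)) y $ i = approx_inverse N CARD('n) y $ i" for i
    using assms(1,2)
  proof (induction rule: nilpotent_induct)
    case (step k i)
    then show ?case
      using morphism_map_cong[of N i "approx_inverse N (Suc k) y" "approx_inverse N k y"] by simp
  qed
  then have "approx_inverse N (Suc CARD('n)) y = G y"
    by (simp add: G_def vec_eq_iff)
  then show ?thesis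
    by (simp add: G_def algebra_simps)
qed

theorem proposition4:
  fixes F :: "real ^ 'n::finite \<Rightarrow> real ^ 'n" and N :: "'n morphism"
  assumes "positive_morphism N" and "nilpotent_morphism N"
    and "F = (\<lambda>x. x + morphism_map N x)"
  shows "polynomially_invertible F"
  unfolding polynomially_invertible_def
  using assms approx_inverse_left[OF assms(1,2)] approx_inverse_right[OF assms(1,2)]
  by (intro exI[of _ "approx_inverse N CARD('n)"])
    (auto simp: fun_eq_iff polynomial_mapping_approx_inverse)

end
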